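(* Let $G=G(n,p)$ be the Erdős–Rényi random graph on vertex set $\{1,\dots,n\}$, $n\ge 2$, in which each of the $\binom{n}{2}$ possible edges is present independently with probability $p\in(0,1)$. For every $\gamma>0$ and every $0<\eta<1$ there are positive constants $M=M(\gamma,\eta)$ and $D=D(\gamma,\eta)$ such that if $p\ge \frac{M\log n}{n}$ then \[ \mathbb{P}\left(\frac{\eta np}{2}\le \chi_{i,\eta}(G)\le D\,np\right)\ge 1-\frac{1}{n^{\gamma}}. \]
   Context: Logarithms are natural. For a vertex $u$, $N(u)$ denotes the set of vertices adjacent to $u$ in $G$ (open neighbourhood). A $k$-colouring of $G$ is any map $f:\{1,\dots,n\}\to\{1,\dots,k\}$ (not necessarily proper). A vertex $v\in N(u)$ is called $(f,N(u))$-unique if $f(v)\neq f(w)$ for all $w\in N(u)$ with $w\neq v$. For $0<\eta<1$, $f$ is an $\eta$-injective colouring of $G$ if for each vertex $u$, at least a fraction $\eta$ of the vertices of $N(u)$ are $(f,N(u))$-unique. $\chi_{i,\eta}(G)$ denotes the minimum number of colours $k$ for which $G$ has an $\eta$-injective $k$-colouring. *)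

theory Defs
  imports "HOL-Probability.Probability"
begin

text \<open>
  A simple graph is given by its vertex set and its set of edges, an edge being a
  two-element set of vertices.
\<close>

definition possible_edges :: "'a set \<Rightarrow> 'a set set" where
  "possible_edges V = {e. e \<subseteq> V \<and> card e = 2}"

definition nbhd :: "'a set set \<Rightarrow> 'a \<Rightarrow> 'a set" where
  "nbhd E u = {v. v \<noteq> u \<and> {u, v} \<in> E}"

definition unique_in :: "('a \<Rightarrow> 'c) \<Rightarrow> 'a set \<Rightarrow> 'a \<Rightarrow> bool" where
  "unique_in f N v \<longleftrightarrow> v \<in> N \<and> (\<forall>w\<in>N. w \<noteq> v \<longrightarrow> f v \<noteq> f w)"

text \<open>
  The requirement is stated without division, so that it holds for isolated vertices.
\<close>

definition eta_injective :: "'a set \<Rightarrow> 'a set set \<Rightarrow> real \<Rightarrow> ('a \<Rightarrow> 'c) \<Rightarrow> bool" where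
  "eta_injective V E \<eta> f \<longleftrightarrow>
     (\<forall>u\<in>V. real (card {v \<in> nbhd E u. unique_in f (nbhd E u) v}) \<ge> \<eta> * real (card (nbhd E u)))"

definition chi_inj :: "'a set \<Rightarrow> 'a set set \<Rightarrow> real \<Rightarrow> nat" where
  "chi_inj V E \<eta> = (LEAST k. \<exists>f \<in> V \<rightarrow> {1..k}. eta_injective V E \<eta> f)"

text \<open>
  The law of the edge set of $G(n,p)$: independent Bernoulli indicators over all possible
  edges, read as the set of edges that are present.
\<close>

definition gnp :: "nat \<Rightarrow> real \<Rightarrow> nat set set pmf" where
  "gnp n p = map_pmf (\<lambda>b. {e \<in> possible_edges {1..n}. b e})
     (Pi_pmf (possible_edges {1..n}) False (\<lambda>_. bernoulli_pmf p))"

text \<open>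
  For \<open>\<eta> \<le> 1\<close> the minimum in \<^const>\<open>chi_inj\<close> is attained, since an injective colouring
  is \<open>\<eta>\<close>-injective.
\<close>

lemma chi_inj_attained:
  fixes V :: "'a set"
  assumes "finite V" and E: "E \<subseteq> possible_edges V" and "\<eta> \<le> 1"
  shows "\<exists>f \<in> V \<rightarrow> {1..chi_inj V E \<eta>}. eta_injective V E \<eta> f"
proof -
  obtain g where g: "bij_betw g V {1..card V}"
    using finite_same_card_bij[of V "{1..card V}"] \<open>finite V\<close> by auto
  have "{v \<in> nbhd E u. unique_in g (nbhd E u) v} = nbhd E u" for u
  proof -
    have "nbhd E u \<subseteq> V"
      using E by (auto simp: nbhd_def possible_edges_def)
    then show ?thesis
      using bij_betw_imp_inj_on[OF g] by (auto simp: unique_in_def inj_on_def)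
  qed
  then have "eta_injective V E \<eta> g"
    using \<open>\<eta> \<le> 1\<close> by (auto simp: eta_injective_def intro: order.trans[OF mult_right_mono[of \<eta> 1]])
  moreover have "g \<in> V \<rightarrow> {1..card V}"
    using g by (auto simp: bij_betw_def)
  ultimately have "\<exists>k::nat. \<exists>f \<in> V \<rightarrow> {1..k}. eta_injective V E \<eta> f"
    by blast
  then show ?thesis
    unfolding chi_inj_def by (rule LeastI_ex)
qed

end

theory Submission
  imports Defs
begin

text \<open>
  Lower bound: the unique neighbours of a vertex have distinct colours, so the number of colours
  is at least \<open>\<eta>\<close> times any degree, and all degrees are at least \<open>np/2\<close> with high probability.

  Upper bound: a fixed colouring suffices, namely the residues modulo \<open>k\<close> with \<open>k\<close> of order \<open>np\<close>;
  its classes have at most \<open>m \<le> 2n/k\<close> vertices if \<open>k < n\<close> (for \<open>k \<ge> n\<close> colour injectively).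
  The neighbourhood of \<open>u\<close> is a random subset of the other vertices and meets the classes
  independently. A class met in \<open>X\<close> vertices contributes \<open>Y = X\<close> non-unique neighbours if
  \<open>X \<ge> 2\<close> and none otherwise. Since \<open>exp Y \<le> (1 + e)^X - e X\<close>, the mean of \<open>exp Y\<close> is at most
  \<open>exp ((e m p)\<^sup>2)\<close>, and the product over the \<open>k\<close> classes is at most \<open>exp (O(np) \<cdot> np/k)\<close>.
  By Markov's inequality more than \<open>(1 - \<eta>) np/2\<close> non-unique neighbours occur with probability
  exponentially small in \<open>np\<close>, which beats the union bound over \<open>u\<close> when \<open>np \<ge> M log n\<close>.
\<close>

section \<open>Random subsets\<close>

text \<open>Shaped like \<open>gnp\<close>, so that the edge set and every neighbourhood are
  instances of one distribution.\<close>

definition random_subset :: "'a set \<Rightarrow> real \<Rightarrow> 'a set pmf" where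
  "random_subset A p = map_pmf (\<lambda>b. {x \<in> A. b x}) (Pi_pmf A False (\<lambda>_. bernoulli_pmf p))"

lemma gnp_eq_random_subset: "gnp n p = random_subset (possible_edges {1..n}) p"
  by (simp add: gnp_def random_subset_def)

lemma set_random_subset: "set_pmf (random_subset A p) \<subseteq> Pow A"
  by (auto simp: random_subset_def)

lemma integrable_random_subset:
  fixes g :: "'a set \<Rightarrow> real"
  assumes "finite A"
  shows "integrable (random_subset A p) g"
  using assms set_random_subset[of A p]
  by (intro integrable_measure_pmf_finite) (auto intro: finite_subset)

text \<open>Independence of the traces on disjoint sets, in the form that lets blocks be split off
  one at a time.\<close>

lemma random_subset_union:
  assumes "finite A" "finite B" "A \<inter> B = {}"
  shows "random_subset (A \<union> B) p =
           map_pmf (\<lambda>(S, T). S \<union> T) (pair_pmf (random_subset A p) (random_subset B p))"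
proof -
  have "{x \<in> A \<union> B. if x \<in> A then f x else g x} = {x \<in> A. f x} \<union> {x \<in> B. g x}" for f g
    using assms(3) by auto
  then show ?thesis
    unfolding random_subset_def Pi_pmf_union[OF assms]
    by (simp add: map_pmf_comp map_pair[symmetric] case_prod_unfold)
qed

text \<open>Induction on \<open>C\<close>, splitting off one block and integrating it separately.
  With nonnegative integrals the iterated integral needs no integrability conditions.\<close>

lemma nn_integral_random_subset_blocks:
  assumes "finite C" "\<And>c. c \<in> C \<Longrightarrow> finite (B c)" "disjoint_family_on B C"
  shows "(\<integral>\<^sup>+S. (\<Prod>c\<in>C. g c (S \<inter> B c)) \<partial>random_subset (\<Union>c\<in>C. B c) p) =
           (\<Prod>c\<in>C. \<integral>\<^sup>+S. g c S \<partial>random_subset (B c) p)"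
  using assms
proof (induction C rule: finite_induct)
  case empty
  show ?case by simp
next
  case (insert d C)
  define U where "U = (\<Union>c\<in>C. B c)"
  have "B d \<inter> B c = {}" if "c \<in> C" for c
    using insert.hyps(2) that by (intro disjoint_family_onD[OF insert.prems(2)]) auto
  then have disj: "B d \<inter> U = {}"
    unfolding U_def by blast
  have fin: "finite (B d)" "finite U"
    using insert.prems(1) insert.hyps(1) by (auto simp: U_def)
  have "(\<integral>\<^sup>+S. (\<Prod>c\<in>insert d C. g c (S \<inter> B c)) \<partial>random_subset (\<Union>c\<in>insert d C. B c) p) =
          (\<integral>\<^sup>+S. \<integral>\<^sup>+T. (\<Prod>c\<in>insert d C. g c ((S \<union> T) \<inter> B c))
             \<partial>random_subset U p \<partial>random_subset (B d) p)"
    using random_subset_union[OF fin disj] by (simp add: U_def nn_integral_pair_pmf')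
  also have "\<dots> = (\<integral>\<^sup>+S. \<integral>\<^sup>+T. g d S * (\<Prod>c\<in>C. g c (T \<inter> B c))
             \<partial>random_subset U p \<partial>random_subset (B d) p)"
  proof (intro nn_integral_cong_AE AE_pmfI)
    fix S T assume "S \<in> set_pmf (random_subset (B d) p)" "T \<in> set_pmf (random_subset U p)"
    then have "S \<subseteq> B d" "T \<subseteq> U"
      using set_random_subset by fast+
    then have "(S \<union> T) \<inter> B d = S" "\<And>c. c \<in> C \<Longrightarrow> (S \<union> T) \<inter> B c = T \<inter> B c"
      using disj unfolding U_def by blast+
    then show "(\<Prod>c\<in>insert d C. g c ((S \<union> T) \<inter> B c)) = g d S * (\<Prod>c\<in>C. g c (T \<inter> B c))"
      using insert.hyps by simp
  qed
  also have "\<dots> = (\<Prod>c\<in>insert d C. \<integral>\<^sup>+S. g c S \<partial>random_subset (B c) p)"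
  proof -
    have "disjoint_family_on B C"
      by (rule disjoint_family_on_mono[OF subset_insertI insert.prems(2)])
    then have "(\<integral>\<^sup>+T. (\<Prod>c\<in>C. g c (T \<inter> B c)) \<partial>random_subset U p) =
                 (\<Prod>c\<in>C. \<integral>\<^sup>+S. g c S \<partial>random_subset (B c) p)"
      unfolding U_def using insert.prems(1) by (intro insert.IH) auto
    then show ?thesis
      using insert.hyps by (simp add: nn_integral_cmult nn_integral_multc)
  qed
  finally show ?case .
qed

text \<open>The generating function of a binomial variable, as a product over independent elements.
  It is used at \<open>z = 1 / 2\<close> for the degrees and at \<open>z = 1 + exp 1\<close> for the
  collisions.\<close>

lemma expectation_power_card_random_subset:
  assumes "finite A" "0 \<le> p" "p \<le> 1" "0 \<le> z"
  shows "measure_pmf.expectation (random_subset A p) (\<lambda>S. z ^ card S) = (1 + p * (z - 1)) ^ card A"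
proof -
  have "measure_pmf.expectation (random_subset A p) (\<lambda>S. z ^ card S) =
          measure_pmf.expectation (Pi_pmf A False (\<lambda>_. bernoulli_pmf p))
            (\<lambda>b. \<Prod>x\<in>A. if b x then z else 1)"
    using assms(1) by (simp add: random_subset_def prod.If_cases Int_def)
  also have "\<dots> = (\<Prod>x\<in>A. measure_pmf.expectation (bernoulli_pmf p) (\<lambda>v. if v then z else 1))"
    using assms by (intro expectation_prod_Pi_pmf integrable_measure_pmf_finite) auto
  also have "\<dots> = (1 + p * (z - 1)) ^ card A"
    using assms by (simp add: algebra_simps)
  finally show ?thesis .
qed

lemma expectation_card_random_subset:
  assumes "finite A" "0 \<le> p" "p \<le> 1"
  shows "measure_pmf.expectation (random_subset A p) (\<lambda>S. real (card S)) = real (card A) * p"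
proof -
  have "measure_pmf.expectation (random_subset A p) (\<lambda>S. real (card S)) =
          measure_pmf.expectation (Pi_pmf A False (\<lambda>_. bernoulli_pmf p))
            (\<lambda>b. \<Sum>x\<in>A. of_bool (b x))"
    using assms(1) by (simp add: random_subset_def Int_def)
  also have "\<dots> = (\<Sum>x\<in>A. measure_pmf.expectation (bernoulli_pmf p) of_bool)"
  proof (subst Bochner_Integration.integral_sum)
    fix x assume x: "x \<in> A"
    have "finite (set_pmf (Pi_pmf A False (\<lambda>_. bernoulli_pmf p)))"
      using assms(1) by (auto simp: set_Pi_pmf)
    then show "integrable (Pi_pmf A False (\<lambda>_. bernoulli_pmf p)) (\<lambda>b. of_bool (b x) :: real)"
      by (rule integrable_measure_pmf_finite)
  next
    show "(\<Sum>x\<in>A. measure_pmf.expectation (Pi_pmf A False (\<lambda>_. bernoulli_pmf p)) (\<lambda>b. of_bool (b x))) =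
          (\<Sum>x\<in>A. measure_pmf.expectation (bernoulli_pmf p) of_bool :: real)"
    proof (rule sum.cong)
      fix x assume "x \<in> A"
      then have "map_pmf (\<lambda>b. b x) (Pi_pmf A False (\<lambda>_. bernoulli_pmf p)) = bernoulli_pmf p"
        using assms(1) by (simp add: Pi_pmf_component)
      from this[symmetric]
      show "measure_pmf.expectation (Pi_pmf A False (\<lambda>_. bernoulli_pmf p)) (\<lambda>b. of_bool (b x)) =
            (measure_pmf.expectation (bernoulli_pmf p) of_bool :: real)"
        by (metis integral_map_pmf)
    qed simp
  qed
  also have "\<dots> = real (card A) * p"
    using assms by simp
  finally show ?thesis .
qed

text \<open>Chernoff's method with base \<open>1 / 2\<close>: the indicator of the event is at most
  \<open>2 powr (s - card S)\<close>. The factor \<open>3 / 4\<close> is a rational upper bound for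
  \<open>ln 2\<close>.\<close>

lemma random_subset_card_lower_tail:
  assumes "finite A" "0 \<le> p" "p \<le> 1" "0 \<le> s"
  shows "measure_pmf.prob (random_subset A p) {S. real (card S) < s}
           \<le> exp (3 / 4 * s - p * real (card A) / 2)"
proof -
  have "measure_pmf.prob (random_subset A p) {S. real (card S) < s} =
          measure_pmf.expectation (random_subset A p) (indicator {S. real (card S) < s})"
    by simp
  also have "\<dots> \<le> measure_pmf.expectation (random_subset A p)
                      (\<lambda>S. 2 powr s * (1 / 2) ^ card S)"
  proof (intro integral_mono integrable_random_subset assms)
    fix S :: "'a set"
    have "1 \<le> 2 powr s * (1 / 2) ^ card S" if "real (card S) < s"
    proof -
      have "(2::real) ^ card S \<le> 2 powr s"
        using that by (subst powr_realpow[symmetric]) (auto intro!: powr_mono)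
      then show ?thesis by (simp add: field_simps)
    qed
    then show "indicator {S. real (card S) < s} S \<le> (2 powr s * (1 / 2) ^ card S :: real)"
      by (auto simp: indicator_def)
  qed
  also have "\<dots> = 2 powr s * (1 - p / 2) ^ card A"
    using assms expectation_power_card_random_subset[of A p "1 / 2"] by simp
  also have "\<dots> \<le> exp (3 / 4 * s) * exp (- p / 2) ^ card A"
  proof (intro mult_mono power_mono)
    have "ln 2 * s \<le> 3 / 4 * s"
      using ln2_le_25_over_36 assms by (intro mult_right_mono) auto
    then show "2 powr s \<le> exp (3 / 4 * s)" by (simp add: powr_def mult.commute)
    show "1 - p / 2 \<le> exp (- p / 2)"
      using exp_ge_add_one_self[of "- p / 2"] by simp
  qed (use assms in auto)
  also have "\<dots> = exp (3 / 4 * s - p * real (card A) / 2)"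
    by (simp add: algebra_simps flip: exp_of_nat_mult exp_add)
  finally show ?thesis .
qed

section \<open>Colliding elements of a random subset\<close>

text \<open>When a neighbourhood meets a colour class in \<open>x\<close> vertices, this is the
  number of non-unique vertices among them.\<close>

definition collisions :: "nat \<Rightarrow> nat" where
  "collisions x = (if x \<ge> 2 then x else 0)"

text \<open>The right-hand side consists of the first two terms and the last term of the binomial
  expansion, which are distinct because \<open>x \<ge> 2\<close>.\<close>

lemma power_one_plus_ge:
  fixes w :: real
  assumes "w \<ge> 0" "x \<ge> 2"
  shows "(1 + w) ^ x \<ge> 1 + w * real x + w ^ x"
  using assms(2)
proof (induction x rule: dec_induct)
  case base
  show ?case by (simp add: power2_eq_square algebra_simps)
next
  case (step x)
  have "1 + w * real (Suc x) + w ^ Suc x \<le> (1 + w) * (1 + w * real x + w ^ x)"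
    using assms(1) by (simp add: algebra_simps)
  also have "\<dots> \<le> (1 + w) ^ Suc x"
    using step.IH assms(1) by (simp add: mult_left_mono)
  finally show ?case .
qed

text \<open>
  The right-hand side has an explicit expectation, in which the terms linear in \<open>p\<close> cancel.
\<close>

lemma exp_collisions_le: "exp (real (collisions x)) \<le> (1 + exp 1) ^ x - exp 1 * real x"
proof (cases "x \<ge> 2")
  case True
  then show ?thesis
    using power_one_plus_ge[of "exp 1" x] by (simp add: collisions_def flip: exp_of_nat_mult)
next
  case False
  \<comment> \<open>Equality holds in both cases; at \<open>x = 1\<close> the subtracted
    \<open>exp 1\<close> brings the right-hand side back to 1.\<close>
  then have "x = 0 \<or> x = 1" by auto
  then show ?thesis by (auto simp: collisions_def)
qed

text \<open>The dominating variable has mean at most \<open>exp y - y\<close> with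
  \<open>y = exp 1 * p * card A\<close>. Only a quadratic term is left, by
  \<open>exp y \<le> 1 + y + y\<^sup>2\<close>, which is where \<open>small\<close> enters.\<close>

lemma expectation_exp_collisions:
  assumes "finite A" "0 \<le> p" "p \<le> 1" and small: "exp 1 * p * real (card A) \<le> 1"
  shows "measure_pmf.expectation (random_subset A p) (\<lambda>S. exp (real (collisions (card S))))
           \<le> exp ((exp 1 * p * real (card A))\<^sup>2)"
proof -
  define y where "y = exp 1 * p * real (card A)"
  have "measure_pmf.expectation (random_subset A p) (\<lambda>S. exp (real (collisions (card S))))
          \<le> measure_pmf.expectation (random_subset A p)
              (\<lambda>S. (1 + exp 1) ^ card S - exp 1 * real (card S))"
    using assms by (intro integral_mono integrable_random_subset exp_collisions_le)
  also have "\<dots> = (1 + p * exp 1) ^ card A - y"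
    using assms expectation_power_card_random_subset[of A p "1 + exp 1"]
    by (simp add: integrable_random_subset expectation_card_random_subset y_def)
  also have "\<dots> \<le> exp (p * exp 1) ^ card A - y"
    using assms by (intro diff_right_mono power_mono exp_ge_add_one_self add_nonneg_nonneg) auto
  also have "\<dots> = exp y - y"
    by (simp add: y_def mult_ac flip: exp_of_nat_mult)
  also have "\<dots> \<le> 1 + y\<^sup>2"
    using exp_bound[of y] assms by (simp add: y_def)
  also have "\<dots> \<le> exp (y\<^sup>2)"
    by (rule exp_ge_add_one_self)
  finally show ?thesis by (simp add: y_def)
qed


text \<open>Markov's inequality for the exponential of the total: the fibres of \<open>f\<close> are
  disjoint, so the moment factors over the colours, and each factor is bounded through
  \<open>m\<close>.\<close>

lemma random_subset_collisions_upper_tail: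
  assumes "finite A" "finite C" "f \<in> A \<rightarrow> C" "0 \<le> p" "p \<le> 1"
    and m: "\<And>c. c \<in> C \<Longrightarrow> card {v \<in> A. f v = c} \<le> m" and small: "exp 1 * p * real m \<le> 1"
  shows "measure_pmf.prob (random_subset A p)
             {S. t < real (\<Sum>c\<in>C. collisions (card {v \<in> S. f v = c}))}
           \<le> exp (real (card C) * (exp 1 * p * real m)\<^sup>2 - t)"
proof -
  define B where "B c = {v \<in> A. f v = c}" for c
  define X where "X S = real (\<Sum>c\<in>C. collisions (card (S \<inter> B c)))" for S
  have A: "A = (\<Union>c\<in>C. B c)"
    using assms(3) by (auto simp: B_def)
  have fin: "finite (B c)" for c
    using assms(1) by (simp add: B_def)
  have block: "(\<integral>\<^sup>+S. ennreal (exp (real (collisions (card S)))) \<partial>random_subset (B c) p)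
                 \<le> ennreal (exp ((exp 1 * p * real m)\<^sup>2))" if "c \<in> C" for c
  proof -
    have le: "exp 1 * p * real (card (B c)) \<le> exp 1 * p * real m"
      using m[OF that] assms by (intro mult_left_mono) (auto simp: B_def)
    have "measure_pmf.expectation (random_subset (B c) p) (\<lambda>S. exp (real (collisions (card S))))
            \<le> exp ((exp 1 * p * real (card (B c)))\<^sup>2)"
      using fin assms(4,5) order.trans[OF le small] by (rule expectation_exp_collisions)
    also have "\<dots> \<le> exp ((exp 1 * p * real m)\<^sup>2)"
      using le assms by (simp add: power_mono)
    finally show ?thesis
      using fin by (subst nn_integral_eq_integral)
        (auto intro: integrable_random_subset ennreal_leI)
  qed
  have "ennreal (measure_pmf.expectation (random_subset A p) (\<lambda>S. exp (X S))) =
          (\<integral>\<^sup>+S. ennreal (exp (X S)) \<partial>random_subset A p)"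
    using assms(1) by (subst nn_integral_eq_integral) (auto intro: integrable_random_subset)
  also have "\<dots> = (\<integral>\<^sup>+S. (\<Prod>c\<in>C. ennreal (exp (real (collisions (card (S \<inter> B c))))))
                     \<partial>random_subset (\<Union>c\<in>C. B c) p)"
    using assms(2) by (simp add: A[symmetric] X_def exp_sum prod_ennreal)
  also have "\<dots> = (\<Prod>c\<in>C. \<integral>\<^sup>+S. ennreal (exp (real (collisions (card S)))) \<partial>random_subset (B c) p)"
    using assms(2) fin
    by (intro nn_integral_random_subset_blocks) (auto simp: B_def disjoint_family_on_def)
  also have "\<dots> \<le> (\<Prod>c\<in>C. ennreal (exp ((exp 1 * p * real m)\<^sup>2)))"
    using block by (intro prod_mono_ennreal)
  also have "\<dots> = ennreal (exp (real (card C) * (exp 1 * p * real m)\<^sup>2))"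
    by (simp add: ennreal_power exp_of_nat_mult)
  finally have moment: "measure_pmf.expectation (random_subset A p) (\<lambda>S. exp (X S))
                          \<le> exp (real (card C) * (exp 1 * p * real m)\<^sup>2)"
    by simp
  have "measure_pmf.prob (random_subset A p)
          {S. t < real (\<Sum>c\<in>C. collisions (card {v \<in> S. f v = c}))}
        \<le> measure_pmf.prob (random_subset A p) {S. t < X S}"
  \<comment> \<open>The two events agree only for \<open>S \<subseteq> A\<close>, hence the
    restriction to the support.\<close>
  proof (intro measure_pmf.finite_measure_mono_AE AE_pmfI impI)
    fix S
    assume "S \<in> set_pmf (random_subset A p)"
    then have "S \<subseteq> A"
      using set_random_subset by fast
    then have "{v \<in> S. f v = c} = S \<inter> B c" for c
      by (auto simp: B_def)
    moreover assume "S \<in> {S. t < real (\<Sum>c\<in>C. collisions (card {v \<in> S. f v = c}))}"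
    ultimately show "S \<in> {S. t < X S}" by (simp add: X_def)
  qed simp
  also have "\<dots> = measure_pmf.expectation (random_subset A p) (indicator {S. t < X S})"
    by simp
  also have "\<dots> \<le> measure_pmf.expectation (random_subset A p) (\<lambda>S. exp (X S) * exp (- t))"
    by (intro integral_mono integrable_random_subset assms)
       (auto simp: indicator_def simp flip: exp_add)
  also have "\<dots> \<le> exp (real (card C) * (exp 1 * p * real m)\<^sup>2) * exp (- t)"
    using moment by simp
  finally show ?thesis by (simp flip: exp_add)
qed

text \<open>A non-unique vertex shares its colour with another vertex of \<open>S\<close>, so
  \<open>collisions\<close> counts its whole colour class.\<close>

lemma card_unique_ge:
  assumes "finite S" "finite C" "f \<in> S \<rightarrow> C"
  shows "card S \<le> card {v \<in> S. unique_in f S v} + (\<Sum>c\<in>C. collisions (card {v \<in> S. f v = c}))"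
proof -
  define R where "R c = {v \<in> S. f v = c \<and> \<not> unique_in f S v}" for c
  have "card (R c) \<le> collisions (card {v \<in> S. f v = c})" for c
  proof (cases "R c = {}")
    case False
    then obtain v w where "v \<in> S" "f v = c" "w \<in> S" "w \<noteq> v" "f w = c"
      by (auto simp: R_def unique_in_def)
    then have "card {v, w} \<le> card {v \<in> S. f v = c}"
      using assms(1) by (intro card_mono) auto
    then have "collisions (card {v \<in> S. f v = c}) = card {v \<in> S. f v = c}"
      using \<open>w \<noteq> v\<close> by (auto simp: collisions_def)
    then show ?thesis
      using assms(1) by (auto simp: R_def intro!: card_mono)
  qed simp
  then have "(\<Sum>c\<in>C. card (R c)) \<le> (\<Sum>c\<in>C. collisions (card {v \<in> S. f v = c}))"
    by (rule sum_mono)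
  moreover have "S = {v \<in> S. unique_in f S v} \<union> (\<Union>c\<in>C. R c)"
    using assms(3) by (auto simp: R_def)
  then have "card S \<le> card {v \<in> S. unique_in f S v} + card (\<Union>c\<in>C. R c)"
    by (metis card_Un_le)
  moreover have "card (\<Union>c\<in>C. R c) \<le> (\<Sum>c\<in>C. card (R c))"
    using assms(2) by (rule card_UN_le)
  ultimately show ?thesis by linarith
qed

section \<open>Neighbourhoods and colourings\<close>

text \<open>The map from \<open>v\<close> to \<open>{u, v}\<close> identifies the other vertices
  with the possible edges at \<open>u\<close>; the rest of the product measure is marginalised
  out.\<close>

lemma nbhd_gnp:
  assumes "u \<in> {1..n}"
  shows "map_pmf (\<lambda>E. nbhd E u) (gnp n p) = random_subset ({1..n} - {u}) p"
proof -
  define A where "A = {1..n} - {u}"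
  define B where "B = (\<lambda>v. {u, v}) ` A"
  have inj: "inj_on (\<lambda>v. {u, v}) A"
    by (auto simp: inj_on_def doubleton_eq_iff)
  have fin: "finite (possible_edges {1..n})"
    by (rule finite_subset[of _ "Pow {1..n}"]) (auto simp: possible_edges_def)
  have B: "B \<subseteq> possible_edges {1..n}"
    using assms by (auto simp: B_def A_def possible_edges_def)
  \<comment> \<open>Reindexing the product along the bijection requires indices outside
    \<open>A\<close> to land outside \<open>B\<close>, where the default \<open>False\<close> is
    taken.\<close>
  have notin: "{u, v} \<notin> B" if "v \<notin> A" for v
    using that by (auto simp: A_def B_def doubleton_eq_iff)
  have "random_subset A p = map_pmf (\<lambda>b. {v \<in> A. b {u, v}})
          (Pi_pmf B False (\<lambda>_. bernoulli_pmf p))"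
    using Pi_pmf_bij_betw[of A "\<lambda>v. {u, v}" B False "bernoulli_pmf p"] inj notin
    by (simp add: random_subset_def A_def B_def bij_betw_def map_pmf_comp)
  also have "\<dots> = map_pmf (\<lambda>b. {v \<in> A. {u, v} \<in> B \<and> b {u, v}})
                     (Pi_pmf (possible_edges {1..n}) False (\<lambda>_. bernoulli_pmf p))"
    unfolding Pi_pmf_subset[OF fin B] map_pmf_comp by (intro map_pmf_cong refl) auto
  also have "\<dots> = map_pmf (\<lambda>E. nbhd E u) (gnp n p)"
    unfolding gnp_def map_pmf_comp
  proof (intro map_pmf_cong refl)
    fix b
    have "v \<in> A" if "v \<noteq> u" "{u, v} \<in> possible_edges {1..n}" for v
      using that by (simp add: A_def possible_edges_def)
    moreover have "{u, v} \<in> B" "v \<noteq> u" if "v \<in> A" for v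
      using that by (simp_all add: A_def B_def)
    ultimately show "{v \<in> A. {u, v} \<in> B \<and> b {u, v}} = nbhd {e \<in> possible_edges {1..n}. b e} u"
      unfolding nbhd_def using B by blast
  qed
  finally show ?thesis by (simp add: A_def)
qed

lemma nbhd_subset: "E \<subseteq> possible_edges V \<Longrightarrow> nbhd E u \<subseteq> V - {u}"
  by (auto simp: nbhd_def possible_edges_def)

lemma chi_inj_le: "f \<in> V \<rightarrow> {1..k} \<Longrightarrow> eta_injective V E \<eta> f \<Longrightarrow> chi_inj V E \<eta> \<le> k"
  unfolding chi_inj_def by (rule Least_le) blast

lemma chi_inj_ge_degree:
  assumes "finite V" "E \<subseteq> possible_edges V" "\<eta> \<le> 1" "u \<in> V"
  shows "\<eta> * real (card (nbhd E u)) \<le> real (chi_inj V E \<eta>)"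
proof -
  obtain f where f: "f \<in> V \<rightarrow> {1..chi_inj V E \<eta>}" "eta_injective V E \<eta> f"
    using chi_inj_attained[OF assms(1-3)] by blast
  define U where "U = {v \<in> nbhd E u. unique_in f (nbhd E u) v}"
  have "U \<subseteq> V"
    using nbhd_subset[OF assms(2)] by (auto simp: U_def)
  then have "f ` U \<subseteq> {1..chi_inj V E \<eta>}"
    using f(1) by auto
  moreover have "inj_on f U"
    by (auto simp: inj_on_def U_def unique_in_def)
  ultimately have "card U \<le> chi_inj V E \<eta>"
    using card_inj_on_le[of f U "{1..chi_inj V E \<eta>}"] by simp
  moreover have "\<eta> * real (card (nbhd E u)) \<le> real (card U)"
    using f(2) assms(4) by (simp add: eta_injective_def U_def)
  ultimately show ?thesis by linarith
qed

lemma chi_inj_le_card: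
  assumes "E \<subseteq> possible_edges {1..n}" "\<eta> \<le> 1"
  shows "chi_inj {1..n} E \<eta> \<le> n"
proof (rule chi_inj_le[where f = id])
  have "{v \<in> nbhd E u. unique_in id (nbhd E u) v} = nbhd E u" for u
    by (auto simp: unique_in_def)
  then show "eta_injective {1..n} E \<eta> id"
    using assms(2) mult_right_mono[of \<eta> 1] by (auto simp: eta_injective_def)
qed auto

text \<open>Collisions are compared with a common lower bound \<open>d\<close> on the degrees, so
  their threshold does not depend on the random degree of \<open>u\<close>.\<close>

lemma eta_injective_if_few_collisions:
  assumes "finite V" "E \<subseteq> possible_edges V" "finite C" "f \<in> V \<rightarrow> C" "\<eta> \<le> 1"
    and deg: "\<And>u. u \<in> V \<Longrightarrow> d \<le> real (card (nbhd E u))"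
    and coll: "\<And>u. u \<in> V \<Longrightarrow>
      real (\<Sum>c\<in>C. collisions (card {v \<in> nbhd E u. f v = c})) \<le> (1 - \<eta>) * d"
  shows "eta_injective V E \<eta> f"
  unfolding eta_injective_def
proof
  fix u assume u: "u \<in> V"
  have sub: "nbhd E u \<subseteq> V"
    using nbhd_subset[OF assms(2)] by blast
  have "card (nbhd E u) \<le> card {v \<in> nbhd E u. unique_in f (nbhd E u) v} +
          (\<Sum>c\<in>C. collisions (card {v \<in> nbhd E u. f v = c}))"
    using sub assms(1,3,4) by (intro card_unique_ge) (auto intro: finite_subset)
  then have "real (card (nbhd E u)) \<le> real (card {v \<in> nbhd E u. unique_in f (nbhd E u) v}) +
          real (\<Sum>c\<in>C. collisions (card {v \<in> nbhd E u. f v = c}))"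
    unfolding of_nat_add[symmetric] by (rule of_nat_mono)
  moreover have "(1 - \<eta>) * d \<le> (1 - \<eta>) * real (card (nbhd E u))"
    using deg[OF u] assms(5) by (intro mult_left_mono) auto
  ultimately show "\<eta> * real (card (nbhd E u)) \<le>
      real (card {v \<in> nbhd E u. unique_in f (nbhd E u) v})"
    using coll[OF u] by (simp add: algebra_simps)
qed

text \<open>Within a residue class \<open>v\<close> is determined by \<open>v div k\<close>, which
  takes values from 0 to \<open>n div k\<close>.\<close>

lemma card_residue_class_le:
  fixes k :: nat
  assumes "k > 0"
  shows "card {v \<in> {1..n}. v mod k = r} \<le> n div k + 1"
proof -
  have "card {v \<in> {1..n}. v mod k = r} \<le> card {..n div k}"
  proof (rule card_inj_on_le)
    show "inj_on (\<lambda>v. v div k) {v \<in> {1..n}. v mod k = r}"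
      by (rule inj_onI) (metis (mono_tags, lifting) div_mult_mod_eq mem_Collect_eq)
  qed (auto intro: div_le_mono)
  then show ?thesis by simp
qed


section \<open>Tail bounds at a single vertex of the random graph\<close>

lemma gnp_degree_lower_tail:
  assumes "u \<in> {1..n}" "0 \<le> p" "p \<le> 1"
  shows "measure_pmf.prob (gnp n p) {E. real (card (nbhd E u)) < real n * p / 2}
           \<le> exp (1 - real n * p / 8)"
proof -
  have "measure_pmf.prob (gnp n p) {E. real (card (nbhd E u)) < real n * p / 2} =
          measure_pmf.prob (random_subset ({1..n} - {u}) p) {S. real (card S) < real n * p / 2}"
    unfolding nbhd_gnp[OF assms(1), symmetric] by (simp add: vimage_def)
  also have "\<dots> \<le> exp (3 / 4 * (real n * p / 2) - p * real (card ({1..n} - {u})) / 2)"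
    using assms by (intro random_subset_card_lower_tail) auto
  also have "real (card ({1..n} - {u})) = real n - 1"
    using assms(1) by simp
  \<comment> \<open>Having \<open>n - 1\<close> instead of \<open>n\<close> other vertices costs
    \<open>p / 2\<close> in the exponent, which the summand 1 absorbs.\<close>
  also have "exp (3 / 4 * (real n * p / 2) - p * (real n - 1) / 2) \<le> exp (1 - real n * p / 8)"
    using assms by (simp add: field_simps)
  finally show ?thesis .
qed

lemma gnp_collisions_upper_tail:
  fixes k n :: nat
  assumes "u \<in> {1..n}" "0 < p" "p \<le> 1" "k < n" "\<delta> > 0" "\<delta> \<le> 3"
    and k: "18 / \<delta> * (real n * p) \<le> real k"
  shows "measure_pmf.prob (gnp n p)
           {E. t < real (\<Sum>c\<in>{1..k}. collisions (card {v \<in> nbhd E u. v mod k + 1 = c}))}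
           \<le> exp (2 * \<delta> * (real n * p) - t)"
proof -
  define A where "A = {1..n} - {u}"
  define m where "m = n div k + 1"
  define y where "y = exp 1 * p * real m"
  have np: "real n * p > 0"
    using assms by simp
  then have "real k > 0"
    using k \<open>\<delta> > 0\<close> by (intro less_le_trans[OF _ k]) auto
  then have "k > 0" by simp
  have "real m \<le> 2 * (real n / real k)"
  proof -
    have "real (n div k) \<le> real n / real k"
      by (rule of_nat_div_le_of_nat)
    \<comment> \<open>Since \<open>k < n\<close>, the extra 1 in the class size costs at most a
      factor 2.\<close>
    moreover have "1 \<le> real n / real k"
      using \<open>k > 0\<close> \<open>k < n\<close> by simp
    ultimately show ?thesis by (simp add: m_def)
  qed
  then have "y \<le> 3 * p * (2 * (real n / real k))"
    unfolding y_def using exp_le assms by (intro mult_mono) auto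
  then have yk: "y * real k \<le> 6 * (real n * p)"
    using \<open>real k > 0\<close> by (simp add: field_simps)
  have y0: "y \<ge> 0"
    using assms by (simp add: y_def)
  have k': "18 * (real n * p) \<le> \<delta> * real k"
    using k \<open>\<delta> > 0\<close> by (simp add: field_simps)
  \<comment> \<open>The constant 18 is \<open>3 * 6\<close>: the 6 comes from
    \<open>exp 1 \<le> 3\<close> and the factor 2 in \<open>m\<close>, and the 3 makes
    \<open>y\<close> at most \<open>\<delta> / 3\<close>, hence at most 1.\<close>
  have "y * real k * 3 \<le> \<delta> * real k"
    using yk k' by linarith
  then have y: "y * 3 \<le> \<delta>"
    using \<open>real k > 0\<close> by (metis mult.assoc mult.commute mult_le_cancel_right_pos)
  have "real k * y\<^sup>2 = (y * real k) * y"
    by (simp add: power2_eq_square)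
  also have "\<dots> \<le> (6 * (real n * p)) * (\<delta> / 3)"
    by (rule mult_mono[OF yk]) (use y y0 np in auto)
  finally have ky: "real k * y\<^sup>2 \<le> 2 * \<delta> * (real n * p)"
    by (simp add: mult_ac)
  have "measure_pmf.prob (gnp n p)
          {E. t < real (\<Sum>c\<in>{1..k}. collisions (card {v \<in> nbhd E u. v mod k + 1 = c}))} =
        measure_pmf.prob (random_subset A p)
          {S. t < real (\<Sum>c\<in>{1..k}. collisions (card {v \<in> S. v mod k + 1 = c}))}"
    unfolding A_def nbhd_gnp[OF assms(1), symmetric] by (simp add: vimage_def)
  also have "\<dots> \<le> exp (real (card {1..k}) * (exp 1 * p * real m)\<^sup>2 - t)"
  proof (rule random_subset_collisions_upper_tail)
    fix c assume "c \<in> {1..k}"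
    then have "{v \<in> A. v mod k + 1 = c} \<subseteq> {v \<in> {1..n}. v mod k = c - 1}"
      by (auto simp: A_def)
    then have "card {v \<in> A. v mod k + 1 = c} \<le> card {v \<in> {1..n}. v mod k = c - 1}"
      by (intro card_mono) auto
    also have "\<dots> \<le> m"
      unfolding m_def using \<open>k > 0\<close> by (rule card_residue_class_le)
    finally show "card {v \<in> A. v mod k + 1 = c} \<le> m" .
  next
    show "(\<lambda>v. v mod k + 1) \<in> A \<rightarrow> {1..k}"
      using \<open>k > 0\<close> by (auto simp: Suc_le_eq)
    show "exp 1 * p * real m \<le> 1"
      using y \<open>\<delta> \<le> 3\<close> by (simp add: y_def)
  qed (use assms in \<open>auto simp: A_def\<close>)
  also have "\<dots> \<le> exp (2 * \<delta> * (real n * p) - t)"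
    using ky by (simp add: y_def)
  finally show ?thesis .
qed

section \<open>Union bound and choice of constants\<close>

lemma union_bound_le_powr:
  fixes n :: nat
  assumes "n \<ge> 2" "(4 + \<gamma>) * ln (real n) \<le> x"
  shows "real n * (2 * exp (1 - x)) \<le> 1 / real n powr \<gamma>"
proof -
  \<comment> \<open>The 4 in \<open>4 + \<gamma>\<close> pays one power of \<open>n\<close> for the
    number of vertices and three for the constant \<open>2 * exp 1\<close>.\<close>
  have "2 * exp 1 \<le> (2::real) ^ 3"
    using exp_le by simp
  also have "\<dots> \<le> real n ^ 3"
    using assms(1) by (intro power_mono) auto
  finally have e: "2 * exp 1 \<le> real n ^ 3" .
  have "exp (- x) \<le> exp (- ((4 + \<gamma>) * ln (real n)))"
    using assms(2) by simp
  also have "\<dots> = real n powr - (4 + \<gamma>)"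
    using assms(1) by (simp add: powr_def algebra_simps)
  finally have x: "exp (- x) \<le> real n powr - (4 + \<gamma>)" .
  have "real n * (2 * exp (1 - x)) = real n * ((2 * exp 1) * exp (- x))"
    by (simp flip: exp_add)
  also have "\<dots> \<le> real n * (real n ^ 3 * real n powr - (4 + \<gamma>))"
    using e x by (intro mult_left_mono mult_mono) auto
  also have "\<dots> = real n ^ 4 * real n powr - (4 + \<gamma>)"
    by (simp add: power_numeral_reduce)
  also have "\<dots> = real n powr 4 * real n powr - (4 + \<gamma>)"
    using assms(1) by simp
  also have "\<dots> = real n powr (- \<gamma>)"
    unfolding powr_add[symmetric] by simp
  finally show ?thesis by (simp add: powr_minus_divide)
qed

theorem theorem1:
  fixes \<gamma> \<eta> :: real
  assumes "\<gamma> > 0" and "0 < \<eta>" and "\<eta> < 1"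
  shows "\<exists>M>0. \<exists>D>0. \<forall>(n::nat) (p::real).
           n \<ge> 2 \<longrightarrow> 0 < p \<longrightarrow> p < 1 \<longrightarrow> p \<ge> M * ln (real n) / real n \<longrightarrow>
           measure_pmf.prob (gnp n p)
             {E. \<eta> * real n * p / 2 \<le> real (chi_inj {1..n} E \<eta>) \<and>
                 real (chi_inj {1..n} E \<eta>) \<le> D * real n * p}
           \<ge> 1 - 1 / real n powr \<gamma>"
proof -
  \<comment> \<open>The collision threshold is then \<open>4 * \<delta> * n * p\<close>, of which
    the moment bound uses \<open>2 * \<delta> * n * p\<close>. As
    \<open>\<delta> \<le> 1 / 8\<close>, both tails fit under
    \<open>exp (1 - \<delta> * n * p)\<close>.\<close>
  define \<delta> where "\<delta> = (1 - \<eta>) / 8"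
  have \<delta>: "0 < \<delta>" "\<delta> \<le> 1 / 8"
    using assms by (auto simp: \<delta>_def)
  \<comment> \<open>Chosen so that \<open>\<delta> * M = 4 + \<gamma>\<close>, the rate that the
    union bound asks for.\<close>
  define M where "M = (4 + \<gamma>) / \<delta>"
  \<comment> \<open>The summand 1 absorbs the rounding up of \<open>k\<close>, because
    \<open>n * p \<ge> 1\<close>.\<close>
  define D where "D = 18 / \<delta> + 1"
  have "M \<ge> 4 / (1 / 8)"
    unfolding M_def using \<delta> assms(1) by (intro frac_le) auto
  then have M: "M \<ge> 32" by simp
  have D: "D > 0"
    using \<delta> by (simp add: D_def add_pos_pos)
  have bound: "1 - 1 / real n powr \<gamma> \<le> measure_pmf.prob (gnp n p)
      {E. \<eta> * real n * p / 2 \<le> real (chi_inj {1..n} E \<eta>) \<and>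
          real (chi_inj {1..n} E \<eta>) \<le> D * real n * p}"
    if n: "n \<ge> 2" and p: "0 < p" "p < 1" and pM: "p \<ge> M * ln (real n) / real n"
    for n :: nat and p :: real
  proof -
    have np: "M * ln (real n) \<le> real n * p"
      using pM n by (simp add: field_simps)
    have "1 \<le> 32 * (2 / 3 :: real)" by simp
    also have "\<dots> \<le> M * ln (real n)"
    proof (intro mult_mono)
      have "ln 2 \<le> ln (real n)"
        using n by simp
      then show "2 / 3 \<le> ln (real n)"
        using ln2_ge_two_thirds by linarith
    qed (use M in auto)
    finally have np1: "1 \<le> real n * p"
      using np by linarith
    define k where "k = nat \<lceil>18 / \<delta> * (real n * p)\<rceil>"
    have k: "18 / \<delta> * (real n * p) \<le> real k"
      unfolding k_def by (rule real_nat_ceiling_ge)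
    have "0 < 18 / \<delta> * (real n * p)"
      using \<delta> np1 by simp
    then have kD: "real k \<le> D * real n * p" and k0: "k > 0"
      using of_int_ceiling_le_add_one[of "18 / \<delta> * (real n * p)"] np1 k
      by (auto simp: k_def D_def algebra_simps)
    define Y where
      "Y E u = real (\<Sum>c\<in>{1..k}. collisions (card {v \<in> nbhd E u. v mod k + 1 = c}))"
      for E and u :: nat
    define few where "few u = {E. real (card (nbhd E u)) < real n * p / 2}" for u :: nat
    \<comment> \<open>The conjunct \<open>k < n\<close> makes this event empty in the case settled
      by the identity colouring.\<close>
    define many where "many u = {E. k < n \<and> (1 - \<eta>) * (real n * p / 2) < Y E u}" for u
    have good: "\<eta> * real n * p / 2 \<le> real (chi_inj {1..n} E \<eta>) \<and>
        real (chi_inj {1..n} E \<eta>) \<le> D * real n * p"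
      if E: "E \<in> set_pmf (gnp n p)" and notbad: "E \<notin> (\<Union>u\<in>{1..n}. few u \<union> many u)" for E
    proof
      have sub: "E \<subseteq> possible_edges {1..n}"
        using E set_random_subset unfolding gnp_eq_random_subset by fast
      have deg: "real n * p / 2 \<le> real (card (nbhd E u))" if "u \<in> {1..n}" for u
        using notbad that by (force simp: few_def not_less)
      \<comment> \<open>One vertex of large degree suffices for the lower bound; vertex 1
        serves.\<close>
      have "\<eta> * (real n * p / 2) \<le> \<eta> * real (card (nbhd E 1))"
        using deg[of 1] n assms by (intro mult_left_mono) auto
      also have "\<dots> \<le> real (chi_inj {1..n} E \<eta>)"
        using sub n assms by (intro chi_inj_ge_degree) auto
      finally show "\<eta> * real n * p / 2 \<le> real (chi_inj {1..n} E \<eta>)"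
        by (simp add: mult.assoc)
      have "chi_inj {1..n} E \<eta> \<le> k"
      proof (cases "k < n")
        case True
        show ?thesis
        proof (rule chi_inj_le)
          show f: "(\<lambda>v. v mod k + 1) \<in> {1..n} \<rightarrow> {1..k}"
            using k0 by (auto simp: Suc_le_eq)
          have "Y E u \<le> (1 - \<eta>) * (real n * p / 2)" if "u \<in> {1..n}" for u
            using notbad that True by (force simp: many_def not_less)
          then show "eta_injective {1..n} E \<eta> (\<lambda>v. v mod k + 1)"
            unfolding Y_def using deg f sub assms(3)
            by (intro eta_injective_if_few_collisions[where C = "{1..k}"]) (assumption | simp)+
        qed
      next
        case False
        then show ?thesis
          using chi_inj_le_card[OF sub, of \<eta>] assms by simp
      qed
      then show "real (chi_inj {1..n} E \<eta>) \<le> D * real n * p"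
        using kD by linarith
    qed
    have bad: "measure_pmf.prob (gnp n p) (few u \<union> many u) \<le> 2 * exp (1 - \<delta> * (real n * p))"
      if u: "u \<in> {1..n}" for u
    proof -
      have "measure_pmf.prob (gnp n p) (few u) \<le> exp (1 - real n * p / 8)"
        unfolding few_def using u p by (intro gnp_degree_lower_tail) auto
      also have "\<dots> \<le> exp (1 - \<delta> * (real n * p))"
        using mult_right_mono[OF \<delta>(2), of "real n * p"] np1 by simp
      finally have 1: "measure_pmf.prob (gnp n p) (few u) \<le> exp (1 - \<delta> * (real n * p))" .
      have 2: "measure_pmf.prob (gnp n p) (many u) \<le> exp (1 - \<delta> * (real n * p))"
      proof (cases "k < n")
        case True
        have "measure_pmf.prob (gnp n p) (many u)
                \<le> exp (2 * \<delta> * (real n * p) - (1 - \<eta>) * (real n * p / 2))"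
          using gnp_collisions_upper_tail[OF u p(1) _ True _ _ k, of "(1 - \<eta>) * (real n * p / 2)"]
            True \<delta> p
          unfolding many_def Y_def by simp
        also have "(1 - \<eta>) * (real n * p / 2) = 4 * (\<delta> * (real n * p))"
          by (simp add: \<delta>_def)
        also have "exp (2 * \<delta> * (real n * p) - 4 * (\<delta> * (real n * p)))
                     \<le> exp (1 - \<delta> * (real n * p))"
        proof -
          have "0 \<le> \<delta> * (real n * p)"
            using \<delta> p by (intro mult_nonneg_nonneg) auto
          then have "2 * \<delta> * (real n * p) - 4 * (\<delta> * (real n * p)) \<le> 1 - \<delta> * (real n * p)"
            unfolding mult.assoc by linarith
          then show ?thesis by simp
        qed
        finally show ?thesis .
      qed (simp add: many_def)
      show ?thesis
        using measure_Un_le[of "few u" "gnp n p" "many u"] 1 2 by simp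
    qed
    have "measure_pmf.prob (gnp n p) (\<Union>u\<in>{1..n}. few u \<union> many u)
            \<le> (\<Sum>u\<in>{1..n}. measure_pmf.prob (gnp n p) (few u \<union> many u))"
      by (intro measure_pmf.finite_measure_subadditive_finite) auto
    also have "\<dots> \<le> real n * (2 * exp (1 - \<delta> * (real n * p)))"
      using sum_mono[of "{1..n}", OF bad] by simp
    also have "\<dots> \<le> 1 / real n powr \<gamma>"
      using n mult_left_mono[OF np, of \<delta>] \<delta>
      by (intro union_bound_le_powr) (auto simp: M_def)
    finally have "1 - 1 / real n powr \<gamma>
        \<le> measure_pmf.prob (gnp n p) (- (\<Union>u\<in>{1..n}. few u \<union> many u))"
      by (subst measure_pmf.prob_compl[simplified, unfolded Compl_eq_Diff_UNIV[symmetric]]) auto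
    \<comment> \<open>The inclusion of events is needed only on the support, where \<open>E\<close>
      consists of possible edges.\<close>
    also have "\<dots> \<le> measure_pmf.prob (gnp n p)
        {E. \<eta> * real n * p / 2 \<le> real (chi_inj {1..n} E \<eta>) \<and>
            real (chi_inj {1..n} E \<eta>) \<le> D * real n * p}"
      using good by (intro measure_pmf.finite_measure_mono_AE AE_pmfI) auto
    finally show ?thesis .
  qed
  show ?thesis
    using M D bound by (intro exI[of _ M] exI[of _ D] conjI allI impI) auto
qed

end
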